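(* For all $\epsilon>0$ and $t\in\mathbb{N}$ there exists $d_0\in\mathbb{N}$ such that for all $d\ge d_0$ and all $n\in\mathbb{N}$, every $n$-vertex graph $G$ of average degree $d$ that contains no subgraph isomorphic to $K_{t,t,t}$ satisfies \[\alpha(G)\ge(1-\epsilon)\frac{n\log d}{d}.\]
   Context: $\alpha(G)$ is the independence number; $K_{t,t,t}$ is the complete tripartite graph with three parts of size $t$; subgraphs need not be induced. $\log$ is the natural logarithm. *)

theory Defs
  imports "Graph_Theory.Digraph_Isomorphism" "Graph_Theory.Pair_Digraph" Complex_Main
begin

text \<open>
  A finite simple graph is a symmetric, loop-free, finite digraph without parallel arcs, i.e. an
  instance of the locale \<^locale>\<open>pair_graph\<close>.  Every edge is represented by two opposite arcs, so
  the degree of a vertex is its out-degree.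
\<close>

definition average_degree :: "'a pair_pre_digraph \<Rightarrow> real" where
  "average_degree G = (\<Sum>v\<in>pverts G. real (out_degree (with_proj G) v)) / real (card (pverts G))"

definition independent_set :: "'a pair_pre_digraph \<Rightarrow> 'a set \<Rightarrow> bool" where
  "independent_set G S \<longleftrightarrow> S \<subseteq> pverts G \<and> (\<forall>u\<in>S. \<forall>v\<in>S. (u, v) \<notin> parcs G)"

definition independence_number :: "'a pair_pre_digraph \<Rightarrow> nat" where
  "independence_number G = Max {card S | S. independent_set G S}"

text \<open>The vertex \<open>(i, x)\<close> is the \<open>x\<close>-th vertex of the \<open>i\<close>-th part.\<close>

definition complete_tripartite :: "nat \<Rightarrow> (nat \<times> nat) pair_pre_digraph" where
  "complete_tripartite t =
     \<lparr> pverts = {0..<3} \<times> {0..<t},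
       parcs = {(u, v). u \<in> {0..<3} \<times> {0..<t} \<and> v \<in> {0..<3} \<times> {0..<t} \<and> fst u \<noteq> fst v} \<rparr>"

text \<open>Not necessarily induced.\<close>

definition contains_copy :: "'a pair_pre_digraph \<Rightarrow> 'b pair_pre_digraph \<Rightarrow> bool" where
  "contains_copy G K \<longleftrightarrow>
     (\<exists>H. pair_graph H \<and> subgraph (with_proj H) (with_proj G) \<and>
          digraph_iso (with_proj H) (with_proj K))"

end

theory Submission
  imports Defs "HOL-Analysis.Convex" "HOL-Real_Asymp.Real_Asymp"
begin

text \<open>
  Shearer's argument for triangle-free graphs deletes a vertex together with its neighbourhood,
  chosen by averaging, and proves \<open>\<alpha>(G) \<ge> n g(d)\<close> for a convex decreasing \<open>g\<close> by induction on
  \<open>n\<close>.  Triangles only enter through the number of edges inside neighbourhoods, and the argument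
  survives with constant \<open>1 - \<epsilon>\<close> as long as every induced subgraph of large average degree \<open>D\<close> has
  at most \<open>\<eta>(D) \<Sum> deg\<^sup>2\<close> ordered triangles with \<open>\<eta>(D) log D \<longrightarrow> 0\<close>; for bounded \<open>D\<close> it suffices that
  \<open>g(D) \<le> 1 / (1 + D)\<close>.  The choice \<open>g(D) = c log(1 + D / A) / D\<close> works.

  The triangle bound holds without any assumption on the maximum degree.  Assign each triangle to a
  vertex \<open>x\<close> of maximal degree and count the copies of \<open>K\<^bsub>t,t\<^esub>\<close> in the part of the neighbourhood of
  \<open>x\<close> of degree at most \<open>deg x\<close>, with weight \<open>(deg x)\<close> to the power \<open>2 - 2 t\<close>.  By convexity many
  triangles give many weighted copies, whereas in a \<open>K\<^bsub>t,t,t\<^esub>\<close>-free graph each copy of \<open>K\<^bsub>t,t\<^esub>\<close> is counted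
  for fewer than \<open>t\<close> vertices \<open>x\<close>, and the weights sum up to \<open>O(\<Sum> deg)\<close>.
\<close>

section \<open>Counting complete bipartite configurations\<close>

lemma convex_on_power_nonneg: "convex_on {0..} (\<lambda>x::real. x ^ n)"
proof (cases "even n")
  case True
  then show ?thesis
    by (rule convex_on_subset[OF convex_power_even]) auto
next
  case False
  then show ?thesis by (rule convex_power_odd)
qed

text \<open>Jensen's inequality for the convex power function with weights normalised to sum 1.
  Clearing the total weight leaves a division-free form that also covers total weight 0.\<close>

lemma weighted_power_mean:
  fixes w f :: "'i \<Rightarrow> real"
  assumes "finite I" "\<And>i. i \<in> I \<Longrightarrow> 0 \<le> w i" "\<And>i. i \<in> I \<Longrightarrow> 0 \<le> f i"
  shows "(\<Sum>i\<in>I. w i * f i) ^ Suc k \<le> (\<Sum>i\<in>I. w i) ^ k * (\<Sum>i\<in>I. w i * f i ^ Suc k)"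
proof (cases "(\<Sum>i\<in>I. w i) = 0")
  case True
  then have "\<And>i. i \<in> I \<Longrightarrow> w i = 0"
    using assms sum_nonneg_eq_0_iff[of I w] by auto
  then show ?thesis by simp
next
  case False
  define W where "W = (\<Sum>i\<in>I. w i)"
  have W: "W > 0"
    using False assms(2) sum_nonneg[of I w] unfolding W_def by fastforce
  have "(\<Sum>i\<in>I. (w i / W) *\<^sub>R f i) ^ Suc k \<le> (\<Sum>i\<in>I. (w i / W) * f i ^ Suc k)"
  proof (rule convex_on_sum[OF assms(1) _ convex_on_power_nonneg])
    show "I \<noteq> {}" using False by auto
    show "(\<Sum>i\<in>I. w i / W) = 1"
      using W by (simp add: W_def flip: sum_divide_distrib)
  qed (use assms W in auto)
  then have "((\<Sum>i\<in>I. w i * f i) / W) ^ Suc k \<le> (\<Sum>i\<in>I. w i * f i ^ Suc k) / W"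
    by (simp add: sum_divide_distrib)
  then have "(\<Sum>i\<in>I. w i * f i) ^ Suc k / W ^ Suc k * W \<le> (\<Sum>i\<in>I. w i * f i ^ Suc k)"
    using W by (simp only: power_divide pos_le_divide_eq)
  then have "(\<Sum>i\<in>I. w i * f i) ^ Suc k / W ^ k \<le> (\<Sum>i\<in>I. w i * f i ^ Suc k)"
    using W by (simp del: power_Suc add: power_Suc2[of W])
  then show ?thesis
    using W unfolding W_def[symmetric] by (simp add: pos_divide_le_eq mult.commute del: power_Suc)
qed

text \<open>Lists with repetition make the count an exact power of \<open>card A\<close>, which is
  what the power mean inequality produces. Degenerate lists are bounded separately by
  \<open>card_nondistinct_tuples_le\<close>.\<close>

definition tuples :: "'a set \<Rightarrow> nat \<Rightarrow> 'a list set" where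
  "tuples A k = {xs. set xs \<subseteq> A \<and> length xs = k}"

lemma finite_tuples: "finite A \<Longrightarrow> finite (tuples A k)"
  unfolding tuples_def by (rule finite_lists_length_eq)

lemma card_tuples: "finite A \<Longrightarrow> card (tuples A k) = card A ^ k"
  unfolding tuples_def by (rule card_lists_length_eq)

text \<open>For symmetric \<open>R\<close> these are the homomorphisms of the complete bipartite
  graph with sides of size \<open>k\<close>, not only its embedded copies.\<close>

definition complete_tuples :: "('a \<Rightarrow> 'a \<Rightarrow> bool) \<Rightarrow> 'a set \<Rightarrow> nat \<Rightarrow> ('a list \<times> 'a list) set" where
  "complete_tuples R A k = {(ys, zs). ys \<in> tuples A k \<and> zs \<in> tuples A k \<and>
     (\<forall>y\<in>set ys. \<forall>z\<in>set zs. R y z)}"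

lemma finite_complete_tuples: "finite A \<Longrightarrow> finite (complete_tuples R A k)"
  unfolding complete_tuples_def
  by (rule finite_subset[of _ "tuples A k \<times> tuples A k"]) (auto simp: finite_tuples)

lemma card_Collect_pair:
  assumes "finite A" "finite B"
  shows "card {(x, y). x \<in> A \<and> y \<in> B \<and> P x y} = (\<Sum>x\<in>A. card {y\<in>B. P x y})"
proof -
  have "{(x, y). x \<in> A \<and> y \<in> B \<and> P x y} = (SIGMA x:A. {y\<in>B. P x y})" by auto
  then show ?thesis using assms by simp
qed

lemma card_Collect_pair_swap:
  assumes "finite A" "finite B"
  shows "(\<Sum>x\<in>A. card {y\<in>B. P x y}) = (\<Sum>y\<in>B. card {x\<in>A. P x y})"
proof -
  have *: "card {z\<in>C. Q z} = (\<Sum>z\<in>C. if Q z then 1 else 0)" if "finite C" for C :: "'c set" and Q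
    using that by (simp flip: sum.inter_filter)
  show ?thesis
    unfolding *[OF assms(1)] *[OF assms(2)] by (rule sum.swap)
qed

text \<open>Two applications of the power mean inequality, as in the Kovari--Sos--Turan theorem.\<close>

lemma card_complete_tuples_ge:
  fixes R :: "'a \<Rightarrow> 'a \<Rightarrow> bool"
  assumes "finite A"
  shows "real (card {(y, z). y \<in> A \<and> z \<in> A \<and> R y z}) ^ (Suc s * Suc s)
    \<le> real (card A) ^ (2 * s * Suc s) * real (card (complete_tuples R A (Suc s)))"
proof -
  define m where "m = real (card {(y, z). y \<in> A \<and> z \<in> A \<and> R y z})"
  define T where "T = tuples A (Suc s)"
  define common where "common zs = {y\<in>A. \<forall>z\<in>set zs. R y z}" for zs
  define P where "P = (\<Sum>zs\<in>T. real (card (common zs)))"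
  note fin = assms finite_tuples[OF assms, of "Suc s", folded T_def]
  have m: "m = (\<Sum>y\<in>A. real (card {z\<in>A. R y z}))"
    unfolding m_def using card_Collect_pair[OF fin(1) fin(1), of R] by simp
  have "{zs \<in> T. \<forall>z\<in>set zs. R y z} = tuples {z\<in>A. R y z} (Suc s)" for y
    by (auto simp: T_def tuples_def)
  then have "(\<Sum>y\<in>A. card {z\<in>A. R y z} ^ Suc s) = (\<Sum>y\<in>A. card {zs \<in> T. \<forall>z\<in>set zs. R y z})"
    using assms card_tuples[of "{z\<in>A. R _ z}" "Suc s"] by (intro sum.cong) (auto simp del: power_Suc)
  also have "\<dots> = (\<Sum>zs\<in>T. card (common zs))"
    unfolding common_def by (rule card_Collect_pair_swap[OF fin])
  finally have "(\<Sum>y\<in>A. real (card {z\<in>A. R y z}) ^ Suc s) = P"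
    unfolding P_def by (simp only: of_nat_power[symmetric] of_nat_sum[symmetric])
  \<comment> \<open>First power mean, over vertices \<open>y\<close>. \<open>P\<close> counts pairs
    of a vertex and a tuple of its neighbours, summed by tuples instead of by vertices.\<close>
  then have 1: "m ^ Suc s \<le> real (card A) ^ s * P"
    unfolding m using weighted_power_mean[of A "\<lambda>_. 1" "\<lambda>y. real (card {z\<in>A. R y z})" s] assms
    by simp
  have "{ys \<in> T. \<forall>y\<in>set ys. \<forall>z\<in>set zs. R y z} = tuples (common zs) (Suc s)" for zs
    by (auto simp: T_def tuples_def common_def)
  moreover have "card (complete_tuples R A (Suc s)) =
      (\<Sum>ys\<in>T. card {zs\<in>T. \<forall>y\<in>set ys. \<forall>z\<in>set zs. R y z})"
    unfolding complete_tuples_def T_def[symmetric] by (rule card_Collect_pair[OF fin(2) fin(2)])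
  ultimately have "card (complete_tuples R A (Suc s)) = (\<Sum>zs\<in>T. card (common zs) ^ Suc s)"
    using card_Collect_pair_swap[OF fin(2) fin(2), of "\<lambda>ys zs. \<forall>y\<in>set ys. \<forall>z\<in>set zs. R y z"]
      card_tuples[of "common _" "Suc s"] assms
    by (simp add: common_def del: power_Suc)
  \<comment> \<open>Second power mean, over the tuples \<open>zs\<close>, of which there are
    \<open>card A ^ Suc s\<close>; this is where the exponent \<open>s * Suc s\<close> comes
    from.\<close>
  moreover have "P ^ Suc s \<le> real (card T) ^ s * (\<Sum>zs\<in>T. real (card (common zs)) ^ Suc s)"
    unfolding P_def using weighted_power_mean[of T "\<lambda>_. 1" "\<lambda>zs. real (card (common zs))" s] fin
    by simp
  moreover have "real (card T) ^ s = real (card A) ^ (s * Suc s)"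
    unfolding T_def card_tuples[OF assms] by (metis mult.commute of_nat_power power_mult)
  ultimately have 2: "P ^ Suc s \<le> real (card A) ^ (s * Suc s) * real (card (complete_tuples R A (Suc s)))"
    by simp
  have "m ^ (Suc s * Suc s) = (m ^ Suc s) ^ Suc s"
    by (rule power_mult)
  also have "\<dots> \<le> (real (card A) ^ s * P) ^ Suc s"
    using 1 by (intro power_mono) (auto simp: m_def)
  also have "\<dots> = real (card A) ^ (s * Suc s) * P ^ Suc s"
    by (simp only: power_mult_distrib power_mult)
  also have "\<dots> \<le> real (card A) ^ (s * Suc s) *
      (real (card A) ^ (s * Suc s) * real (card (complete_tuples R A (Suc s))))"
    using 2 by (intro mult_left_mono) auto
  also have "\<dots> = real (card A) ^ (2 * s * Suc s) * real (card (complete_tuples R A (Suc s)))"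
    by (simp only: mult_2 power_add mult.assoc distrib_right)
  finally show ?thesis unfolding m_def .
qed

text \<open>A list \<open>x # xs\<close> has a repetition only if \<open>xs\<close> has one or
  \<open>x\<close> occurs in \<open>xs\<close>, and the latter leaves at most \<open>k\<close>
  choices of \<open>x\<close> for each \<open>xs\<close>. Thus a random tuple is degenerate with
  probability at most \<open>k\<^sup>2 / card A\<close>; the factor \<open>card A\<close> on the
  left avoids the division.\<close>

lemma card_nondistinct_tuples_le:
  assumes "finite A"
  shows "card {xs \<in> tuples A k. \<not> distinct xs} * card A \<le> k\<^sup>2 * card A ^ k"
proof (induction k)
  case 0
  have *: "{xs \<in> tuples A 0. \<not> distinct xs} = {}" by (auto simp: tuples_def)
  show ?case unfolding * by simp
next
  case (Suc k)
  let ?B = "\<lambda>k. {xs \<in> tuples A k. \<not> distinct xs}"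
  let ?C = "SIGMA xs:tuples A k. set xs"
  have "?B (Suc k) \<subseteq> (\<lambda>(x, xs). x # xs) ` (A \<times> ?B k) \<union> (\<lambda>(xs, x). x # xs) ` ?C"
  proof
    fix ys assume ys: "ys \<in> ?B (Suc k)"
    then obtain x xs where "ys = x # xs" by (cases ys) (auto simp: tuples_def)
    then show "ys \<in> (\<lambda>(x, xs). x # xs) ` (A \<times> ?B k) \<union> (\<lambda>(xs, x). x # xs) ` ?C"
    proof (cases "x \<in> set xs")
      case True
      then have "(xs, x) \<in> ?C"
        using ys \<open>ys = x # xs\<close> by (auto simp: tuples_def)
      then show ?thesis
        unfolding \<open>ys = x # xs\<close> by (intro UnI2 rev_image_eqI) auto
    next
      case False
      then have "(x, xs) \<in> A \<times> ?B k"
        using ys \<open>ys = x # xs\<close> by (auto simp: tuples_def)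
      then show ?thesis
        unfolding \<open>ys = x # xs\<close> by (intro UnI1 rev_image_eqI) auto
    qed
  qed
  moreover have fin: "finite (A \<times> ?B k)" "finite ?C"
    using assms finite_tuples[of A k] by auto
  ultimately have "card (?B (Suc k)) \<le>
      card ((\<lambda>(x, xs). x # xs) ` (A \<times> ?B k) \<union> (\<lambda>(xs, x). x # xs) ` ?C)"
    by (intro card_mono) auto
  also have "\<dots> \<le> card ((\<lambda>(x, xs). x # xs) ` (A \<times> ?B k)) + card ((\<lambda>(xs, x). x # xs) ` ?C)"
    by (rule card_Un_le)
  also have "\<dots> \<le> card (A \<times> ?B k) + card ?C"
    using fin by (intro add_mono card_image_le)
  also have "card ?C = (\<Sum>xs\<in>tuples A k. card (set xs))"
    using assms finite_tuples[of A k] by simp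
  also have "\<dots> \<le> (\<Sum>xs\<in>tuples A k. k)"
    by (intro sum_mono) (auto simp: tuples_def card_length)
  finally have "card (?B (Suc k)) \<le> card A * card (?B k) + card A ^ k * k"
    using assms by (simp add: card_tuples card_cartesian_product)
  then have "card (?B (Suc k)) * card A \<le> (card A * card (?B k) + card A ^ k * k) * card A"
    by (rule mult_right_mono) simp
  also have "\<dots> = card A * (card (?B k) * card A) + k * card A ^ Suc k"
    by (simp add: algebra_simps)
  also have "\<dots> \<le> card A * (k\<^sup>2 * card A ^ k) + k * card A ^ Suc k"
    using Suc by (intro add_right_mono mult_left_mono) auto
  also have "\<dots> = (k\<^sup>2 + k) * card A ^ Suc k"
    by (simp add: algebra_simps)
  also have "\<dots> \<le> (Suc k)\<^sup>2 * card A ^ Suc k"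
    by (intro mult_right_mono) (auto simp: power2_eq_square)
  finally show ?case .
qed

section \<open>Triangles and degrees\<close>

text \<open>The graph is a fixed relation while the vertex set is an argument, so passing to an
  induced subgraph only changes \<open>V\<close>.\<close>

locale sym_irrefl_relation =
  fixes E :: "'a \<Rightarrow> 'a \<Rightarrow> bool"
  assumes sym: "E x y \<Longrightarrow> E y x" and irrefl: "\<not> E x x"
begin

definition nbhd :: "'a set \<Rightarrow> 'a \<Rightarrow> 'a set" where
  "nbhd V v = {u\<in>V. E v u}"

definition deg :: "'a set \<Rightarrow> 'a \<Rightarrow> nat" where
  "deg V v = card (nbhd V v)"

text \<open>Ties are kept, so a triangle may be counted at several of its vertices, which is
  harmless for an upper bound.\<close>

definition low_nbhd :: "'a set \<Rightarrow> 'a \<Rightarrow> 'a set" where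
  "low_nbhd V x = {y \<in> nbhd V x. deg V y \<le> deg V x}"

text \<open>Irreflexivity of \<open>E\<close> forces three such sets to be pairwise disjoint. For
  \<open>t = 0\<close> the empty sets qualify, so the property then fails.\<close>

definition tripartite_free :: "nat \<Rightarrow> 'a set \<Rightarrow> bool" where
  "tripartite_free t V \<longleftrightarrow> \<not> (\<exists>A B C. A \<subseteq> V \<and> B \<subseteq> V \<and> C \<subseteq> V \<and>
     card A = t \<and> card B = t \<and> card C = t \<and>
     (\<forall>a\<in>A. \<forall>b\<in>B. E a b) \<and> (\<forall>a\<in>A. \<forall>c\<in>C. E a c) \<and> (\<forall>b\<in>B. \<forall>c\<in>C. E b c))"

lemma tripartite_freeD:
  assumes "tripartite_free t V" "A \<subseteq> V" "B \<subseteq> V" "C \<subseteq> V" "card A = t" "card B = t" "card C = t"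
    "\<forall>a\<in>A. \<forall>b\<in>B. E a b" "\<forall>a\<in>A. \<forall>c\<in>C. E a c" "\<forall>b\<in>B. \<forall>c\<in>C. E b c"
  shows False
  using assms unfolding tripartite_free_def by metis

lemma finite_nbhd [simp]: "finite V \<Longrightarrow> finite (nbhd V v)"
  by (simp add: nbhd_def)

lemma finite_low_nbhd [simp]: "finite V \<Longrightarrow> finite (low_nbhd V v)"
  by (simp add: low_nbhd_def)

lemma card_low_nbhd_le: "finite V \<Longrightarrow> card (low_nbhd V x) \<le> deg V x"
  unfolding deg_def by (intro card_mono) (auto simp: low_nbhd_def)

lemma deg_pos: "finite V \<Longrightarrow> u \<in> V \<Longrightarrow> E v u \<Longrightarrow> 0 < deg V v"
  unfolding deg_def nbhd_def by (auto simp: card_gt_0_iff)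

text \<open>A repetition on one of the two sides costs a factor of order 1 / \<open>deg V x\<close>
  among the at most \<open>deg V x ^ (2 * Suc s)\<close> pairs of tuples. After weighting,
  degenerate pairs therefore contribute only a multiple of the degree, the same order as the bound
  for distinct tuples.\<close>

lemma card_nondistinct_complete_tuples_le:
  assumes "finite V"
  shows "card {p \<in> complete_tuples E (low_nbhd V x) (Suc s). \<not> (distinct (fst p) \<and> distinct (snd p))}
           / real (deg V x) ^ (2 * s) \<le> 2 * real (Suc s) ^ 2 * real (deg V x)"
    (is "real (card ?B) / _ \<le> _")
proof (cases "deg V x = 0")
  case True
  then have "low_nbhd V x = {}"
    using assms by (auto simp: deg_def low_nbhd_def)
  then have "?B = {}" by (auto simp: complete_tuples_def tuples_def)
  then show ?thesis by (simp only: card.empty) simp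
next
  case False
  define d where "d = deg V x"
  define T where "T = tuples (nbhd V x) (Suc s)"
  define N where "N = {xs \<in> T. \<not> distinct xs}"
  have fin: "finite T" "finite N"
    unfolding N_def T_def using assms finite_tuples[of "nbhd V x"] by auto
  have arrange: "2 * (c * (d * e)) * (d * e) = 2 * c * d * (e * e) * d" for c e :: nat
    by simp
  have "d ^ (2 * s) = d ^ s * d ^ s"
    by (simp add: mult_2 power_add)
  have T: "card T = d ^ Suc s"
    unfolding T_def d_def deg_def using assms by (intro card_tuples) auto
  have N: "card N * d \<le> (Suc s)\<^sup>2 * d ^ Suc s"
    unfolding N_def T_def d_def deg_def using assms by (intro card_nondistinct_tuples_le) auto
  have "tuples (low_nbhd V x) (Suc s) \<subseteq> T"
    by (auto simp: T_def tuples_def low_nbhd_def)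
  then have "?B \<subseteq> N \<times> T \<union> T \<times> N"
    unfolding N_def complete_tuples_def by auto
  then have "card ?B \<le> card (N \<times> T \<union> T \<times> N)"
    using fin by (intro card_mono) auto
  also have "\<dots> \<le> card (N \<times> T) + card (T \<times> N)"
    by (rule card_Un_le)
  also have "\<dots> = 2 * (card N * card T)"
    by (simp add: card_cartesian_product)
  finally have "card ?B * d \<le> 2 * (card N * card T) * d"
    by (rule mult_right_mono) simp
  also have "\<dots> = 2 * (card N * d) * d ^ Suc s"
    by (simp add: T)
  also have "\<dots> \<le> 2 * ((Suc s)\<^sup>2 * d ^ Suc s) * d ^ Suc s"
    using N by (intro mult_right_mono mult_left_mono) auto
  also have "\<dots> = (2 * (Suc s)\<^sup>2 * d * d ^ (2 * s)) * d"
    unfolding \<open>d ^ (2 * s) = d ^ s * d ^ s\<close> power_Suc by (rule arrange)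
  finally have "card ?B \<le> 2 * (Suc s)\<^sup>2 * d * d ^ (2 * s)"
    using False by (simp add: d_def)
  then have "real (card ?B) \<le> real (2 * (Suc s)\<^sup>2 * d * d ^ (2 * s))"
    by (rule of_nat_mono)
  then have "real (card ?B) \<le> 2 * real (Suc s) ^ 2 * real d * real d ^ (2 * s)"
    by (simp only: of_nat_mult of_nat_power of_nat_numeral)
  then show ?thesis
    using False unfolding d_def by (simp add: pos_divide_le_eq)
qed

text \<open>Fix the adjacent heads \<open>y\<close> and \<open>z\<close>. The tail of the first list
  lies in the neighbourhood of \<open>z\<close> and the tail of the second in that of
  \<open>y\<close>, so the number of choices of tails cancels the weight exactly. What remains is
  one unit per ordered adjacent pair.\<close>

lemma sum_complete_tuples_weight_le:
  assumes "finite V"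
  shows "(\<Sum>p\<in>complete_tuples E V (Suc s).
            1 / (real (deg V (hd (fst p))) ^ s * real (deg V (hd (snd p))) ^ s))
         \<le> real (\<Sum>v\<in>V. deg V v)"
proof -
  define w where "w p = 1 / (real (deg V (hd (fst p))) ^ s * real (deg V (hd (snd p))) ^ s)"
    for p :: "'a list \<times> 'a list"
  \<comment> \<open>Adjacency between the two tails is dropped, so \<open>I\<close> overcounts the
    complete tuples.\<close>
  define I where "I = (SIGMA y:V. SIGMA z:nbhd V y. tuples (nbhd V z) s \<times> tuples (nbhd V y) s)"
  define h where "h = (\<lambda>(y, z, ys, zs). (y # ys :: 'a list, z # zs :: 'a list))"
  have fin: "finite (tuples (nbhd V z) s)" for z
    using assms by (simp add: finite_tuples)
  have "complete_tuples E V (Suc s) \<subseteq> h ` I"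
  proof
    fix p assume p: "p \<in> complete_tuples E V (Suc s)"
    then obtain y ys z zs where *: "p = (y # ys, z # zs)"
      by (cases p; cases "fst p"; cases "snd p") (auto simp: complete_tuples_def tuples_def)
    have "(y, z, ys, zs) \<in> I"
      using p unfolding * I_def
      by (auto simp: complete_tuples_def tuples_def nbhd_def intro: sym)
    then show "p \<in> h ` I"
      unfolding * h_def by (rule rev_image_eqI) simp
  qed
  then have "sum w (complete_tuples E V (Suc s)) \<le> sum w (h ` I)"
    using assms fin by (intro sum_mono2) (auto simp: I_def w_def)
  also have "\<dots> = (\<Sum>i\<in>I. w (h i))"
    by (subst sum.reindex) (auto simp: h_def inj_on_def)
  also have "\<dots> = (\<Sum>(y, z, ys, zs)\<in>I. 1 / (real (deg V y) ^ s * real (deg V z) ^ s))"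
    by (intro sum.cong) (auto simp: h_def w_def)
  also have "\<dots> = (\<Sum>y\<in>V. \<Sum>z\<in>nbhd V y. \<Sum>_\<in>tuples (nbhd V z) s \<times> tuples (nbhd V y) s.
      1 / (real (deg V y) ^ s * real (deg V z) ^ s))"
    unfolding I_def using assms fin
    by (subst sum.Sigma[symmetric], simp, simp, subst sum.Sigma[symmetric])
       (auto simp: case_prod_unfold)
  also have "\<dots> = (\<Sum>y\<in>V. \<Sum>z\<in>nbhd V y. 1)"
  proof (intro sum.cong refl)
    fix y z assume yz: "y \<in> V" "z \<in> nbhd V y"
    then have "deg V y > 0" "deg V z > 0"
      using deg_pos[OF assms] sym unfolding nbhd_def by blast+
    moreover have "card (tuples (nbhd V z) s \<times> tuples (nbhd V y) s) = deg V z ^ s * deg V y ^ s"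
      using assms by (simp add: card_cartesian_product card_tuples deg_def)
    ultimately show "(\<Sum>_\<in>tuples (nbhd V z) s \<times> tuples (nbhd V y) s.
        1 / (real (deg V y) ^ s * real (deg V z) ^ s)) = 1"
      by simp
  qed
  finally show ?thesis
    unfolding w_def by (simp add: deg_def)
qed

text \<open>A vertex completing a copy of the bipartite graph on \<open>(ys, zs)\<close> has degree at least that of the
  heads of \<open>ys\<close> and \<open>zs\<close>, and there are at most \<open>s\<close> such vertices.\<close>

lemma sum_distinct_complete_tuples_le:
  assumes "finite V" "tripartite_free (Suc s) V"
  shows "(\<Sum>x\<in>V. card {p \<in> complete_tuples E (low_nbhd V x) (Suc s). distinct (fst p) \<and> distinct (snd p)}
            / real (deg V x) ^ (2 * s)) \<le> real (Suc s) * real (\<Sum>v\<in>V. deg V v)"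
proof -
  define w where "w p = 1 / (real (deg V (hd (fst p))) ^ s * real (deg V (hd (snd p))) ^ s)"
    for p :: "'a list \<times> 'a list"
  define Q where "Q = {p \<in> complete_tuples E V (Suc s). distinct (fst p) \<and> distinct (snd p)}"
  define X where "X p = {x\<in>V. p \<in> complete_tuples E (low_nbhd V x) (Suc s)}" for p
  have fin: "finite Q" "finite (X p)" for p
    using assms finite_complete_tuples[of V E "Suc s"] by (auto simp: Q_def X_def)
  have "{p \<in> complete_tuples E (low_nbhd V x) (Suc s). distinct (fst p) \<and> distinct (snd p)}
      = {p \<in> Q. p \<in> complete_tuples E (low_nbhd V x) (Suc s)}" for x
    by (auto simp: Q_def complete_tuples_def tuples_def low_nbhd_def nbhd_def)
  then have "(\<Sum>x\<in>V. card {p \<in> complete_tuples E (low_nbhd V x) (Suc s). distinct (fst p) \<and> distinct (snd p)}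
            / real (deg V x) ^ (2 * s))
    = (\<Sum>x\<in>V. \<Sum>p\<in>{p \<in> Q. p \<in> complete_tuples E (low_nbhd V x) (Suc s)}. 1 / real (deg V x) ^ (2 * s))"
    by simp
  also have "\<dots> = (\<Sum>p\<in>Q. \<Sum>x\<in>X p. 1 / real (deg V x) ^ (2 * s))"
    unfolding X_def using assms fin by (intro sum.swap_restrict) auto
  also have "\<dots> \<le> (\<Sum>p\<in>Q. real (Suc s) * w p)"
  proof (rule sum_mono)
    fix p assume p: "p \<in> Q"
    then obtain y ys z zs where *: "p = (y # ys, z # zs)"
      by (cases p; cases "fst p"; cases "snd p") (auto simp: Q_def complete_tuples_def tuples_def)
    have "card (X p) \<le> s"
    proof (rule ccontr)
      assume "\<not> card (X p) \<le> s"
      then obtain A where A: "A \<subseteq> X p" "card A = Suc s"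
        using fin by (metis not_less_eq_eq obtain_subset_with_card_n)
      \<comment> \<open>Distinctness enters here: both lists have entry sets of full size, and with
        \<open>A\<close> they would form a forbidden tripartite configuration.\<close>
      have "card (set (fst p)) = Suc s" "card (set (snd p)) = Suc s"
        "set (fst p) \<subseteq> V" "set (snd p) \<subseteq> V" "\<forall>b\<in>set (fst p). \<forall>c\<in>set (snd p). E b c"
        using p by (auto simp: Q_def complete_tuples_def tuples_def distinct_card)
      moreover have "A \<subseteq> V"
        using A(1) by (auto simp: X_def)
      moreover have "set (fst p) \<subseteq> low_nbhd V a" "set (snd p) \<subseteq> low_nbhd V a" if "a \<in> A" for a
        using subsetD[OF A(1) that] by (auto simp: X_def complete_tuples_def tuples_def)
      then have "\<forall>a\<in>A. \<forall>b\<in>set (fst p). E a b" "\<forall>a\<in>A. \<forall>b\<in>set (snd p). E a b"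
        by (auto simp: low_nbhd_def nbhd_def)
      ultimately show False
        using tripartite_freeD[OF assms(2), of A "set (fst p)" "set (snd p)"] A(2) by simp
    qed
    have "1 / real (deg V x) ^ (2 * s) \<le> w p" if "x \<in> X p" for x
    proof -
      have "y \<in> low_nbhd V x" "z \<in> low_nbhd V x"
        using that by (auto simp: X_def * complete_tuples_def tuples_def)
      moreover have "y \<in> V" "z \<in> V" "E y z"
        using p by (auto simp: * Q_def complete_tuples_def tuples_def)
      ultimately have "deg V y \<le> deg V x" "deg V z \<le> deg V x" "deg V y > 0" "deg V z > 0"
        using deg_pos[OF assms(1)] sym by (auto simp: low_nbhd_def)
      then have "real (deg V y) ^ s * real (deg V z) ^ s \<le> real (deg V x) ^ s * real (deg V x) ^ s"
        "0 < real (deg V y) ^ s * real (deg V z) ^ s"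
        by (auto intro!: mult_mono power_mono)
      then show ?thesis
        unfolding w_def * mult_2 power_add by (intro divide_left_mono) auto
    qed
    then have "(\<Sum>x\<in>X p. 1 / real (deg V x) ^ (2 * s)) \<le> real (card (X p)) * w p"
      by (rule sum_bounded_above)
    also have "\<dots> \<le> real (Suc s) * w p"
      using \<open>card (X p) \<le> s\<close> by (intro mult_right_mono) (auto simp: w_def)
    finally show "(\<Sum>x\<in>X p. 1 / real (deg V x) ^ (2 * s)) \<le> real (Suc s) * w p" .
  qed
  also have "\<dots> = real (Suc s) * sum w Q"
    by (rule sum_distrib_left[symmetric])
  also have "sum w Q \<le> sum w (complete_tuples E V (Suc s))"
    using assms finite_complete_tuples[of V E "Suc s"] by (intro sum_mono2) (auto simp: Q_def w_def)
  also have "\<dots> \<le> real (\<Sum>v\<in>V. deg V v)"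
    unfolding w_def by (rule sum_complete_tuples_weight_le[OF assms(1)])
  finally show ?thesis
    by simp
qed

lemma sum_complete_tuples_le:
  assumes "finite V" "tripartite_free (Suc s) V"
  shows "(\<Sum>x\<in>V. card (complete_tuples E (low_nbhd V x) (Suc s)) / real (deg V x) ^ (2 * s))
    \<le> 3 * real (Suc s) ^ 2 * real (\<Sum>v\<in>V. deg V v)"
proof -
  let ?CT = "\<lambda>x. complete_tuples E (low_nbhd V x) (Suc s)"
  let ?D = "\<lambda>p :: 'a list \<times> 'a list. distinct (fst p) \<and> distinct (snd p)"
  have "card (?CT x) = card {p \<in> ?CT x. ?D p} + card {p \<in> ?CT x. \<not> ?D p}" for x
    using assms finite_complete_tuples[of "low_nbhd V x" E "Suc s"]
    by (subst card_Un_disjoint[symmetric]) (auto intro: arg_cong[where f = card])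
  then have "(\<Sum>x\<in>V. card (?CT x) / real (deg V x) ^ (2 * s))
    = (\<Sum>x\<in>V. card {p \<in> ?CT x. ?D p} / real (deg V x) ^ (2 * s))
    + (\<Sum>x\<in>V. card {p \<in> ?CT x. \<not> ?D p} / real (deg V x) ^ (2 * s))"
    by (simp only: of_nat_add add_divide_distrib sum.distrib)
  also have "\<dots> \<le> real (Suc s) * real (\<Sum>v\<in>V. deg V v) + (\<Sum>x\<in>V. 2 * real (Suc s) ^ 2 * real (deg V x))"
    by (intro add_mono sum_mono sum_distinct_complete_tuples_le card_nondistinct_complete_tuples_le assms)
  also have "\<dots> = (real (Suc s) + 2 * real (Suc s) ^ 2) * real (\<Sum>v\<in>V. deg V v)"
    by (simp add: sum_distrib_left[symmetric] distrib_right)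
  \<comment> \<open>The constant is 1 + 2, since \<open>Suc s\<close> is at most its square.\<close>
  also have "\<dots> \<le> (3 * real (Suc s) ^ 2) * real (\<Sum>v\<in>V. deg V v)"
    by (intro mult_right_mono) (auto simp: power2_eq_square sum_nonneg)
  finally show ?thesis .
qed

text \<open>Power mean over \<open>x\<close>, with weights \<open>d x ^ 2\<close>, of the edge
  densities \<open>m x / d x ^ 2\<close> in the low neighbourhoods. The exponent is that of
  \<open>card_complete_tuples_ge\<close>; the powers of the degree then combine to the weight
  \<open>1 / d x ^ (2 * s)\<close> of \<open>sum_complete_tuples_le\<close>.\<close>

lemma low_triangles_power_le:
  assumes "finite V" "tripartite_free (Suc s) V"
  shows "(\<Sum>x\<in>V. real (card {(y, z). y \<in> low_nbhd V x \<and> z \<in> low_nbhd V x \<and> E y z})) ^ (Suc s * Suc s)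
    \<le> (\<Sum>v\<in>V. real (deg V v) ^ 2) ^ (s * Suc s + s) * (3 * real (Suc s) ^ 2 * real (\<Sum>v\<in>V. deg V v))"
proof -
  have frac_le_frac: "a / c \<le> k / b" if "a * b \<le> k * c" "0 < b" "0 < c" for a b c k :: real
    using that by (simp add: field_simps)
  define m where "m x = real (card {(y, z). y \<in> low_nbhd V x \<and> z \<in> low_nbhd V x \<and> E y z})" for x
  define d where "d x = real (deg V x)" for x
  define N where "N = s * Suc s + s"
  have N: "Suc s * Suc s = Suc N" "2 * s * Suc s + 2 * s = 2 * N"
    by (auto simp: N_def algebra_simps)
  have zero: "low_nbhd V x = {}" if "d x = 0" for x
    using that assms by (auto simp: d_def deg_def low_nbhd_def)
  have m0: "m x = 0" if "d x = 0" for x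
    unfolding m_def zero[OF that] by simp
  \<comment> \<open>At degree 0 both sides contribute 0, as \<open>m x\<close> vanishes
    there.\<close>
  have "(\<Sum>x\<in>V. m x) = (\<Sum>x\<in>V. d x ^ 2 * (m x / d x ^ 2))"
    using m0 by (intro sum.cong) auto
  then have "(\<Sum>x\<in>V. m x) ^ Suc N \<le> (\<Sum>x\<in>V. d x ^ 2) ^ N * (\<Sum>x\<in>V. d x ^ 2 * (m x / d x ^ 2) ^ Suc N)"
    using weighted_power_mean[of V "\<lambda>x. d x ^ 2" "\<lambda>x. m x / d x ^ 2" N] assms
    by (simp only: m_def) simp
  also have "(\<Sum>x\<in>V. d x ^ 2 * (m x / d x ^ 2) ^ Suc N)
      \<le> (\<Sum>x\<in>V. card (complete_tuples E (low_nbhd V x) (Suc s)) / d x ^ (2 * s))"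
  proof (rule sum_mono)
    fix x assume "x \<in> V"
    let ?k = "real (card (complete_tuples E (low_nbhd V x) (Suc s)))"
    show "d x ^ 2 * (m x / d x ^ 2) ^ Suc N \<le> ?k / d x ^ (2 * s)"
    proof (cases "d x = 0")
      case False
      then have d: "d x > 0" by (simp add: d_def)
      have "m x ^ Suc N \<le> real (card (low_nbhd V x)) ^ (2 * s * Suc s) * ?k"
        unfolding m_def N(1)[symmetric] using assms by (intro card_complete_tuples_ge) simp
      also have "\<dots> \<le> d x ^ (2 * s * Suc s) * ?k"
        unfolding d_def using card_low_nbhd_le[OF assms(1)] by (intro mult_right_mono power_mono) auto
      finally have "m x ^ Suc N * d x ^ (2 * s) \<le> ?k * d x ^ (2 * s * Suc s) * d x ^ (2 * s)"
        using d by (simp add: mult.commute)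
      also have "\<dots> = ?k * d x ^ (2 * N)"
        unfolding N(2)[symmetric] power_add by simp
      finally have "m x ^ Suc N / d x ^ (2 * N) \<le> ?k / d x ^ (2 * s)"
        using d by (intro frac_le_frac) auto
      also have "m x ^ Suc N / d x ^ (2 * N) = d x ^ 2 * (m x / d x ^ 2) ^ Suc N"
        using d by (simp add: power_divide power_mult power2_eq_square power_mult_distrib)
      finally show ?thesis .
    qed (simp add: m0)
  qed
  also have "\<dots> \<le> 3 * real (Suc s) ^ 2 * real (\<Sum>v\<in>V. deg V v)"
    unfolding d_def by (rule sum_complete_tuples_le[OF assms])
  finally show ?thesis
    unfolding m_def d_def N(1)[symmetric] N_def[symmetric]
    by (simp add: sum_nonneg mult_left_mono)
qed

end

section \<open>The convex function\<close>

text \<open>The value at 0 is the limit, so that tangent lines at positive points also bound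
  \<open>phi 0\<close> from below.\<close>

definition phi :: "real \<Rightarrow> real" where
  "phi x = (if x = 0 then 1 else ln (1 + x) / x)"

text \<open>This is the derivative of \<open>phi\<close> at a positive point.\<close>

definition phi_slope :: "real \<Rightarrow> real" where
  "phi_slope x = 1 / (x * (1 + x)) - ln (1 + x) / x\<^sup>2"

lemma phi_le_1: "0 \<le> x \<Longrightarrow> phi x \<le> 1"
  unfolding phi_def using ln_add_one_self_le_self[of x] by (auto simp: divide_le_eq)

lemma phi_nonneg: "0 \<le> x \<Longrightarrow> 0 \<le> phi x"
  unfolding phi_def by auto

text \<open>The sign matters in the averaging step, where the slope multiplies an expression that is
  bounded from above.\<close>

lemma phi_slope_nonpos:
  assumes "0 < x"
  shows "phi_slope x \<le> 0"
proof -
  have "ln (1 / (1 + x)) \<le> 1 / (1 + x) - 1"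
    using assms by (intro ln_le_minus_one) auto
  then have "x / (1 + x) \<le> ln (1 + x)"
    using assms by (simp add: ln_div field_simps)
  then have "x / (1 + x) / x\<^sup>2 \<le> ln (1 + x) / x\<^sup>2"
    by (rule divide_right_mono) simp
  then show ?thesis
    using assms by (simp add: phi_slope_def power2_eq_square mult.commute)
qed

text \<open>\<open>phi x\<close> is the integral of \<open>1 / (1 + s * x)\<close> over \<open>s \<in> {0..1}\<close>; the tangent inequality for
  \<open>1 / (1 + s * x)\<close> is integrated over \<open>s\<close>.\<close>

lemma phi_tangent:
  assumes "0 < x" "0 \<le> y"
  shows "phi x + phi_slope x * (y - x) \<le> phi y"
proof -
  define L where "L s = (if y = 0 then s else ln (1 + s * y) / y)" for s
  \<comment> \<open>\<open>P s\<close> is the integral over \<open>r\<close> in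
    \<open>{0..s}\<close> of \<open>1 / (1 + r * y)\<close> minus the value at \<open>y\<close> of
    the tangent, taken at \<open>x\<close>, of the map sending \<open>x\<close> to
    \<open>1 / (1 + r * x)\<close>. The term - 1 normalises \<open>P 0\<close> to 0.\<close>
  define P where "P s = L s - ln (1 + s * x) / x
      + (y - x) / x\<^sup>2 * (ln (1 + s * x) + 1 / (1 + s * x) - 1)" for s
  have "P 0 \<le> P 1"
  proof (rule DERIV_nonneg_imp_nondecreasing[where f = P])
    fix s :: real assume s: "0 \<le> s" "s \<le> 1"
    have pos: "1 + s * x > 0" "1 + s * y > 0"
      using assms s by (auto intro: add_pos_nonneg)
    have "(L has_real_derivative 1 / (1 + s * y)) (at s)"
      unfolding L_def using assms pos by (cases "y = 0") (auto intro!: derivative_eq_intros)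
    moreover have "((\<lambda>s. - ln (1 + s * x) / x
      + (y - x) / x\<^sup>2 * (ln (1 + s * x) + 1 / (1 + s * x) - 1)) has_real_derivative
        - (1 / (1 + s * x)) + (y - x) / x\<^sup>2 * (x / (1 + s * x) - x / (1 + s * x)\<^sup>2)) (at s)"
      using assms pos by (auto intro!: derivative_eq_intros simp: power2_eq_square)
    ultimately have "((\<lambda>s. L s + (- ln (1 + s * x) / x
        + (y - x) / x\<^sup>2 * (ln (1 + s * x) + 1 / (1 + s * x) - 1))) has_real_derivative 1 / (1 + s * y) +
        (- (1 / (1 + s * x)) + (y - x) / x\<^sup>2 * (x / (1 + s * x) - x / (1 + s * x)\<^sup>2))) (at s)"
      by (rule DERIV_add)
    then have deriv: "(P has_real_derivative 1 / (1 + s * y) +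
        (- (1 / (1 + s * x)) + (y - x) / x\<^sup>2 * (x / (1 + s * x) - x / (1 + s * x)\<^sup>2))) (at s)"
      unfolding P_def by (simp add: algebra_simps)
    have "x / (1 + s * x) - x / (1 + s * x)\<^sup>2 = x\<^sup>2 * (s / (1 + s * x)\<^sup>2)"
    proof -
      have "x / a - x / a\<^sup>2 = x * (a - 1) / a\<^sup>2" if "a > 0" for a
        using that by (simp add: field_simps power2_eq_square)
      from this[OF pos(1)] show ?thesis
        by (simp add: power2_eq_square)
    qed
    moreover have "(1 + s * y) - (1 + s * x) = (y - x) * s"
      by (simp add: algebra_simps)
    ultimately have "(y - x) / x\<^sup>2 * (x / (1 + s * x) - x / (1 + s * x)\<^sup>2)
        = ((1 + s * y) - (1 + s * x)) / (1 + s * x)\<^sup>2"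
      using assms by (simp only:) simp
    moreover have "1 / b + (- (1 / a) + (b - a) / a\<^sup>2) \<ge> 0" if "a > 0" "b > 0" for a b :: real
    proof -
      have "1 / b + (- (1 / a) + (b - a) / a\<^sup>2) = (b - a)\<^sup>2 / (b * a\<^sup>2)"
        using that by (simp add: field_simps power2_eq_square)
      then show ?thesis using that by simp
    qed
    ultimately show "\<exists>z. (P has_real_derivative z) (at s) \<and> 0 \<le> z"
      using pos deriv by metis
  qed simp
  moreover have "P 0 = 0" by (simp add: P_def L_def)
  moreover have "P 1 = phi y - phi x - phi_slope x * (y - x)"
  proof -
    have "1 / (1 + x) - 1 = - (x / (1 + x))"
      using assms by (simp add: field_simps)
    then have "ln (1 + x) + 1 / (1 + x) - 1 = ln (1 + x) - x / (1 + x)"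
      by linarith
    moreover have "(y - x) / k * (p - q) = (y - x) * (p / k - q / k)" for p q k :: real
      by (simp flip: diff_divide_distrib)
    ultimately have "(y - x) / x\<^sup>2 * (ln (1 + x) + 1 / (1 + x) - 1)
      = (y - x) * (ln (1 + x) / x\<^sup>2 - x / (1 + x) / x\<^sup>2)"
      by (simp only:)
    also have "x / (1 + x) / x\<^sup>2 = 1 / (x * (1 + x))"
      using assms by (simp add: power2_eq_square)
    finally show ?thesis
      using assms by (simp add: P_def L_def phi_def phi_slope_def algebra_simps)
  qed
  ultimately show ?thesis by simp
qed

text \<open>With \<open>g D = c / A * phi (D / A)\<close> this is Shearer's differential inequality
  1 - (1 + D) g + g' (D - D^2) >= 0, loosened by \<open>\<eta>\<close> for the triangles. After
  substitution the main term \<open>c * D / (A + D)\<close> is at most \<open>c\<close>, and the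
  remaining 1 - c pays for the errors of size \<open>(\<eta> + 2 / D) * ln (1 + D)\<close>.\<close>

lemma phi_shearer_inequality:
  fixes A D c \<eta> :: real
  assumes "A \<ge> 1" "D > 0" "0 \<le> c" "c \<le> 1" "\<eta> \<ge> 0"
    and small: "(\<eta> + 2 / D) * ln (1 + D) \<le> 1 - c"
  shows "0 \<le> 1 - (1 + D) * (c / A * phi (D / A))
    + c / A\<^sup>2 * phi_slope (D / A) * (D - (1 - \<eta>) * D\<^sup>2)"
proof -
  define L where "L = ln (1 + D / A)"
  have L: "0 \<le> L" "L \<le> ln (1 + D)"
    using assms by (auto simp: L_def divide_le_eq mult_le_cancel_left1 add_pos_nonneg)
  have g: "c / A * phi (D / A) = c * L / D"
    using assms by (simp add: phi_def L_def)
  have "D / A * (1 + D / A) = D * (A + D) / A\<^sup>2"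
    using assms by (simp add: field_simps power2_eq_square)
  then have "phi_slope (D / A) = A\<^sup>2 * (1 / (D * (A + D)) - L / D\<^sup>2)"
    unfolding phi_slope_def L_def[symmetric] by (simp add: power_divide right_diff_distrib)
  then have b: "c / A\<^sup>2 * phi_slope (D / A) = c * (1 / (D * (A + D)) - L / D\<^sup>2)"
    using assms by simp
  define q where "q = c / (A + D) - c * L / D"
  have "1 / (D * (A + D)) * D = 1 / (A + D)" "L / D\<^sup>2 * D = L / D"
    using assms by (simp_all add: power2_eq_square)
  then have "c * (1 / (D * (A + D)) - L / D\<^sup>2) * D = q"
    unfolding q_def by (simp only: left_diff_distrib right_diff_distrib mult.assoc) simp
  moreover have "c * (1 / (D * (A + D)) - L / D\<^sup>2) * (D - (1 - \<eta>) * D\<^sup>2)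
      = c * (1 / (D * (A + D)) - L / D\<^sup>2) * D * (1 - (1 - \<eta>) * D)"
    by (simp only: right_diff_distrib power2_eq_square mult_ac mult_1_right left_diff_distrib)
  moreover have "q * D = c * D / (A + D) - c * L"
    using assms unfolding q_def by (simp add: left_diff_distrib)
  moreover have "q * (1 - (1 - \<eta>) * D) = q - (1 - \<eta>) * (q * D)"
    by (simp add: algebra_simps)
  ultimately have "c * (1 / (D * (A + D)) - L / D\<^sup>2) * (D - (1 - \<eta>) * D\<^sup>2)
      = c / (A + D) - c * L / D - (1 - \<eta>) * (c * D / (A + D) - c * L)"
    unfolding q_def by simp
  moreover have "(1 + D) * (c * L / D) = c * L / D + c * L"
    using assms by (simp add: field_simps)
  moreover have "c * ((\<eta> + 2 / D) * L) = \<eta> * (c * L) + 2 * (c * L / D)"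
    by (simp add: algebra_simps)
  moreover have "1 - (w + p) + (r - w - (1 - \<eta>) * (u - p)) = 1 + r - (\<eta> * p + 2 * w) - u + \<eta> * u"
    for w p r u :: real
    by (simp add: algebra_simps)
  ultimately have eq: "1 - (1 + D) * (c / A * phi (D / A))
    + c / A\<^sup>2 * phi_slope (D / A) * (D - (1 - \<eta>) * D\<^sup>2)
     = 1 + c / (A + D) - c * ((\<eta> + 2 / D) * L) - c * D / (A + D) + \<eta> * (c * D / (A + D))"
    unfolding g b by presburger
  have "c * ((\<eta> + 2 / D) * L) \<le> 1 * ((\<eta> + 2 / D) * ln (1 + D))"
    using L assms by (intro mult_mono) auto
  moreover have "c * D / (A + D) \<le> c"
    using assms by (simp add: field_simps)
  moreover have "0 \<le> \<eta> * (c * D / (A + D))" "0 \<le> c / (A + D)"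
    using assms by auto
  ultimately show ?thesis
    unfolding eq using small by linarith
qed

section \<open>Shearer's argument with few triangles\<close>

context sym_irrefl_relation
begin

section \<open>Edge and triangle counts under deletion of a closed neighbourhood\<close>

definition adj :: "'a \<Rightarrow> 'a \<Rightarrow> real" where
  "adj x y = of_bool (E x y)"

definition total :: "'a set \<Rightarrow> real" where
  "total V = (\<Sum>v\<in>V. real (deg V v))"

definition square_sum :: "'a set \<Rightarrow> real" where
  "square_sum V = (\<Sum>v\<in>V. (real (deg V v))\<^sup>2)"

text \<open>Twice the number of edges inside the neighbourhood of \<open>v\<close>.\<close>

definition link :: "'a set \<Rightarrow> 'a \<Rightarrow> real" where
  "link V v = (\<Sum>y\<in>nbhd V v. \<Sum>z\<in>nbhd V v. adj y z)"

text \<open>Ordered triples are counted, so each triangle contributes six.\<close>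

definition triangles :: "'a set \<Rightarrow> real" where
  "triangles V = (\<Sum>v\<in>V. link V v)"

lemma adj_sym: "adj x y = adj y x"
  using sym by (auto simp: adj_def)

lemma sum_nbhd: "finite V \<Longrightarrow> sum f (nbhd V v) = (\<Sum>u\<in>V. adj v u * f u)"
  unfolding nbhd_def adj_def by (simp add: sum.inter_filter of_bool_def if_distrib[where f = "\<lambda>x. x * _"] cong: if_cong)

lemma deg_eq_sum: "finite V \<Longrightarrow> real (deg V v) = (\<Sum>u\<in>V. adj v u)"
  using sum_nbhd[of V "\<lambda>_. 1" v] by (simp add: deg_def)

lemma sum_sum_nbhd_deg:
  assumes "finite V"
  shows "(\<Sum>v\<in>V. \<Sum>u\<in>nbhd V v. real (deg V u)) = square_sum V"
proof -
  have "(\<Sum>v\<in>V. \<Sum>u\<in>nbhd V v. real (deg V u)) = (\<Sum>u\<in>V. \<Sum>v\<in>V. adj v u * real (deg V u))"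
    unfolding sum_nbhd[OF assms] by (rule sum.swap)
  also have "\<dots> = (\<Sum>u\<in>V. (\<Sum>v\<in>V. adj u v) * real (deg V u))"
    by (simp add: sum_distrib_right adj_sym)
  finally show ?thesis
    by (simp add: square_sum_def power2_eq_square deg_eq_sum[OF assms])
qed

text \<open>A neighbour \<open>y\<close> of \<open>v\<close> spends one unit of its degree on
  \<open>v\<close> itself, which lies outside the neighbourhood of \<open>v\<close>.\<close>

lemma link_le:
  assumes "finite V" "v \<in> V"
  shows "link V v \<le> (\<Sum>u\<in>nbhd V v. real (deg V u)) - real (deg V v)"
proof -
  have "(\<Sum>z\<in>nbhd V v. adj y z) \<le> real (deg V y) - 1" if "y \<in> nbhd V v" for y
  proof -
    have "(\<Sum>z\<in>insert v (nbhd V v). adj y z) \<le> (\<Sum>z\<in>V. adj y z)"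
      using assms by (intro sum_mono2) (auto simp: nbhd_def adj_def)
    moreover have "adj y v = 1" "v \<notin> nbhd V v"
      using that sym irrefl by (auto simp: nbhd_def adj_def)
    ultimately show ?thesis
      using assms by (simp add: deg_eq_sum)
  qed
  then have "link V v \<le> (\<Sum>y\<in>nbhd V v. real (deg V y) - 1)"
    unfolding link_def by (rule sum_mono)
  then show ?thesis
    by (simp add: sum_subtractf deg_def)
qed

text \<open>This trivial bound serves the range of small average degree, where no assumption on
  triangles is made.\<close>

lemma triangles_le:
  assumes "finite V"
  shows "triangles V \<le> square_sum V - total V"
proof -
  have "triangles V \<le> (\<Sum>v\<in>V. (\<Sum>u\<in>nbhd V v. real (deg V u)) - real (deg V v))"
    unfolding triangles_def using assms by (intro sum_mono link_le)
  then show ?thesis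
    by (simp add: sum_subtractf sum_sum_nbhd_deg[OF assms] total_def)
qed

lemma square_sum_ge:
  assumes "finite V"
  shows "(total V)\<^sup>2 \<le> real (card V) * square_sum V"
  using sum_squared_le_sum_of_squares[of "\<lambda>v. real (deg V v)" V] assms
  by (cases "V = {}") (auto simp: total_def square_sum_def field_simps)

text \<open>Inclusion-exclusion for the deleted set \<open>B\<close>: the pairs inside the rest are
  e(V,V) - 2 e(B,V) + e(B,B). The contributions of \<open>deg V v\<close> to the last two terms
  cancel.\<close>

lemma total_delete:
  assumes "finite V" "v \<in> V"
  shows "total (V - insert v (nbhd V v))
    = total V - 2 * (\<Sum>u\<in>nbhd V v. real (deg V u)) + link V v"
proof -
  define B where "B = insert v (nbhd V v)"
  define e where "e X Y = (\<Sum>x\<in>X. \<Sum>y\<in>Y. adj x y)" for X Y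
  have B: "B \<subseteq> V" "finite B" "v \<notin> nbhd V v"
    using assms irrefl by (auto simp: B_def nbhd_def)
  have swap: "e X Y = e Y X" for X Y
    unfolding e_def by (subst sum.swap) (simp add: adj_sym)
  have minus: "e X (V - B) = e X V - e X B" for X
    unfolding e_def using assms B by (simp add: sum_diff sum_subtractf)
  have tot: "total X = e X X" if "finite X" for X
    using that by (simp add: total_def e_def deg_eq_sum)
  have "e (V - B) (V - B) = e V V - 2 * e B V + e B B"
    by (simp add: minus swap[of "V - B"])
      (simp add: minus swap[of V B])
  moreover have "e B V = (\<Sum>u\<in>nbhd V v. real (deg V u)) + real (deg V v)"
    unfolding e_def using assms B(3) by (simp add: B_def deg_eq_sum)
  moreover have "e B B = link V v + 2 * real (deg V v)"
  proof -
    have "adj v u = 1" "adj u v = 1" if "u \<in> nbhd V v" for u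
      using that sym by (auto simp: nbhd_def adj_def)
    moreover have "adj v v = 0" using irrefl by (simp add: adj_def)
    ultimately show ?thesis
      unfolding e_def link_def using assms B(3)
      by (simp add: B_def sum.distrib deg_def)
  qed
  ultimately show ?thesis
    using assms B tot[of V] tot[of "V - B"] by (simp add: B_def)
qed

lemma card_delete:
  assumes "finite V" "v \<in> V"
  shows "real (card (V - insert v (nbhd V v))) = real (card V) - 1 - real (deg V v)"
proof -
  have "insert v (nbhd V v) \<subseteq> V" "card (insert v (nbhd V v)) = Suc (deg V v)"
    using assms irrefl by (auto simp: nbhd_def deg_def)
  then show ?thesis
    using assms card_mono[of V "insert v (nbhd V v)"] by (simp add: card_Diff_subset finite_subset)
qed

text \<open>Averaging over \<open>v\<close>: summed over all vertices, the difference of the two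
  sides is exactly the expression assumed nonnegative. Here \<open>g\<close> and \<open>b\<close>
  stand for value and slope at \<open>D\<close> of Shearer's function; the tangent bound for the
  rest is multiplied by its order, so no average degree of a possibly empty rest appears.\<close>

lemma exists_vertex_to_delete:
  fixes g b :: real
  assumes V: "finite V" "V \<noteq> {}" and "D = total V / card V"
    and ineq: "0 \<le> real (card V) * (1 - (1 + D) * g)
      + b * (real (card V) * (D + D\<^sup>2) - 2 * square_sum V + triangles V)"
  obtains v where "v \<in> V" "real (card V) * g \<le> 1
      + real (card (V - insert v (nbhd V v))) * g
      + b * (total (V - insert v (nbhd V v)) - real (card (V - insert v (nbhd V v))) * D)"
proof -
  define n where "n = real (card V)"
  define s where "s v = (\<Sum>u\<in>nbhd V v. real (deg V u))" for v
  have n: "n > 0" using V by (simp add: n_def card_gt_0_iff)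
  then have tot: "total V = n * D" by (simp add: assms(3) n_def)
  have *: "1 + real (card (V - insert v (nbhd V v))) * g
      + b * (total (V - insert v (nbhd V v)) - real (card (V - insert v (nbhd V v))) * D)
    = n * g + (1 - g + b * D) + (b * D - g) * real (deg V v) - 2 * b * s v + b * link V v"
    if "v \<in> V" for v
    using that V by (simp add: total_delete card_delete tot n_def s_def algebra_simps)
  have "(\<Sum>v\<in>V. n * g + (1 - g + b * D) + (b * D - g) * real (deg V v) - 2 * b * s v + b * link V v)
     = n * (n * g + (1 - g + b * D)) + (b * D - g) * total V - 2 * b * square_sum V + b * triangles V"
    unfolding total_def triangles_def sum_sum_nbhd_deg[OF V(1), symmetric] s_def n_def
    by (simp add: sum.distrib sum_subtractf sum_distrib_left)
  also have "\<dots> = n * (n * g) + (n * (1 - (1 + D) * g) + b * (n * (D + D\<^sup>2) - 2 * square_sum V + triangles V))"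
    unfolding tot by (simp add: algebra_simps power2_eq_square)
  also have "\<dots> \<ge> n * (n * g)"
    using ineq by (simp add: n_def)
  finally have sum_ge: "(\<Sum>v\<in>V. n * g) \<le> (\<Sum>v\<in>V. n * g + (1 - g + b * D)
      + (b * D - g) * real (deg V v) - 2 * b * s v + b * link V v)"
    by (simp add: n_def)
  have "\<exists>v\<in>V. n * g \<le> n * g + (1 - g + b * D) + (b * D - g) * real (deg V v) - 2 * b * s v + b * link V v"
  proof (rule ccontr)
    assume "\<not> ?thesis"
    then have "(\<Sum>v\<in>V. n * g + (1 - g + b * D) + (b * D - g) * real (deg V v) - 2 * b * s v
        + b * link V v) < (\<Sum>v\<in>V. n * g)"
      using V by (intro sum_strict_mono) (auto simp: not_le)
    then show False using sum_ge by linarith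
  qed
  then obtain v where "v \<in> V" "n * g \<le> n * g + (1 - g + b * D) + (b * D - g) * real (deg V v)
      - 2 * b * s v + b * link V v" by blast
  then show ?thesis
    using that[of v] *[of v] by (simp add: n_def)
qed

definition independent :: "'a set \<Rightarrow> bool" where
  "independent I \<longleftrightarrow> (\<forall>u\<in>I. \<forall>v\<in>I. \<not> E u v)"

text \<open>Induction on the vertex set: delete the closed neighbourhood of a suitable vertex, add
  that vertex to the independent set of the rest, and compare through the tangent of the convex
  bound at \<open>D\<close>. Assuming few triangles for every \<open>U\<close> within
  \<open>V\<close> lets the hypothesis descend to the rest.\<close>

lemma independent_set_few_triangles:
  fixes A c :: real and \<eta> :: "real \<Rightarrow> real"
  assumes "finite V" and A: "A \<ge> 2" and c: "0 \<le> c" "c \<le> 1"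
    and \<eta>: "\<And>D. D \<ge> A - 1 \<Longrightarrow> 0 \<le> \<eta> D \<and> (\<eta> D + 2 / D) * ln (1 + D) \<le> 1 - c"
    and few: "\<And>U. U \<subseteq> V \<Longrightarrow> U \<noteq> {} \<Longrightarrow> total U / card U \<ge> A - 1 \<Longrightarrow>
      triangles U \<le> \<eta> (total U / card U) * square_sum U"
  shows "\<exists>I\<subseteq>V. independent I \<and> card V * (c / A * phi (total V / card V / A)) \<le> card I"
  using assms(1) few
proof (induction V rule: finite_psubset_induct)
  case (psubset V)
  define n where "n = real (card V)"
  define D where "D = total V / card V"
  define g where "g x = c / A * phi (x / A)" for x
  define b where "b = c / A\<^sup>2 * phi_slope (D / A)"
  have D0: "D \<ge> 0" by (simp add: D_def total_def sum_nonneg)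
  have g_le: "g x \<le> 1 / A" "0 \<le> g x" if "x \<ge> 0" for x
    using A c phi_le_1[of "x / A"] phi_nonneg[of "x / A"] that mult_mono[of c 1 "phi (x / A)" 1]
    by (auto simp: g_def field_simps)
  consider "V = {}" | "V \<noteq> {}" "D = 0" | "V \<noteq> {}" "D > 0"
    using D0 by linarith
  then show ?case
  proof cases
    case 1
    then show ?thesis by (auto simp: independent_def)
  next
    \<comment> \<open>The tangent inequality needs a positive base point, so the edgeless case is
      settled directly.\<close>
    case 2
    then have "total V = 0"
      using psubset by (simp add: D_def)
    then have "independent V"
      using deg_pos[OF psubset.hyps(1)] psubset.hyps(1)
      by (fastforce simp: total_def independent_def sum_nonneg_eq_0_iff)
    moreover have "n * g D \<le> n * 1"
      using g_le(1)[OF D0] A by (intro mult_left_mono order_trans[OF g_le(1)[OF D0]]) (auto simp: n_def)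
    ultimately show ?thesis
      unfolding g_def D_def n_def by auto
  next
    case 3
    have n: "n > 0" using psubset 3 by (simp add: n_def card_gt_0_iff)
    have tot: "total V = n * D" using n by (simp add: D_def n_def)
    have b: "b \<le> 0"
      unfolding b_def using A c 3 by (intro mult_nonneg_nonpos phi_slope_nonpos) auto
    have S: "n * D\<^sup>2 \<le> square_sum V"
      using square_sum_ge[OF psubset.hyps(1)] n unfolding tot
      by (simp add: n_def[symmetric] power2_eq_square mult_ac)
    have tri: "triangles V \<le> square_sum V - n * D"
      using triangles_le[OF psubset.hyps(1)] by (simp add: tot)
    have tangent: "g D + b * (x - D) \<le> g x" if "x \<ge> 0" for x
    proof -
      have "c / A * (phi (D / A) + phi_slope (D / A) * (x / A - D / A)) \<le> c / A * phi (x / A)"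
        using A c 3 that by (intro mult_left_mono phi_tangent) auto
      then show ?thesis
        using A by (simp add: g_def b_def power2_eq_square field_simps)
    qed
    have "0 \<le> n * (1 - (1 + D) * g D) + b * (n * (D + D\<^sup>2) - 2 * square_sum V + triangles V)"
    proof (cases "D \<ge> A - 1")
      case True
      have \<eta>D: "0 \<le> \<eta> D" "(\<eta> D + 2 / D) * ln (1 + D) \<le> 1 - c"
        using \<eta>[OF True] by auto
      \<comment> \<open>This makes the coefficient \<open>2 - \<eta> D\<close> nonnegative, so that
        \<open>square_sum V\<close> may be replaced by its lower bound \<open>n * D\<^sup>2\<close>.
        It follows from \<open>ln (1 + D)\<close> being at least 1/2 for \<open>D\<close> at least
        1.\<close>
      have "\<eta> D \<le> 2"
      proof -
        have "ln (1 / (1 + D)) \<le> 1 / (1 + D) - 1"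
          using 3 by (intro ln_le_minus_one) auto
        then have "- ln (1 + D) \<le> 1 / (1 + D) - 1"
          using 3 by (simp add: ln_div)
        moreover have "1 / (1 + D) \<le> 1 / 2"
          using True A by (intro divide_left_mono) auto
        ultimately have "1 / 2 \<le> ln (1 + D)"
          by linarith
        then have "\<eta> D * (1/2) \<le> (\<eta> D + 2 / D) * ln (1 + D)"
          using \<eta>D 3 by (intro mult_mono) auto
        then show ?thesis using \<eta>D c by linarith
      qed
      have "triangles V \<le> \<eta> D * square_sum V"
        unfolding D_def using True 3 by (intro psubset.prems) (auto simp: D_def)
      moreover have "(2 - \<eta> D) * (n * D\<^sup>2) \<le> (2 - \<eta> D) * square_sum V"
        using S \<open>\<eta> D \<le> 2\<close> by (intro mult_left_mono) auto
      ultimately have "n * (D + D\<^sup>2) - 2 * square_sum V + triangles V \<le> n * (D - (1 - \<eta> D) * D\<^sup>2)"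
        by (simp add: algebra_simps)
      then have "b * (n * (D - (1 - \<eta> D) * D\<^sup>2)) \<le> b * (n * (D + D\<^sup>2) - 2 * square_sum V + triangles V)"
        using b by (rule mult_left_mono_neg)
      moreover have "0 \<le> n * (1 - (1 + D) * g D + b * (D - (1 - \<eta> D) * D\<^sup>2))"
        unfolding g_def b_def using n A c 3 \<eta>D
        by (intro mult_nonneg_nonneg phi_shearer_inequality) auto
      ultimately show ?thesis by (simp add: algebra_simps)
    next
      \<comment> \<open>For small \<open>D\<close> the trivial triangle bound already makes the
        factor of \<open>b\<close> nonpositive, and \<open>g D\<close> is at most
        \<open>1 / A\<close>, below \<open>1 / (1 + D)\<close>.\<close>
      case False
      have "n * (D + D\<^sup>2) - 2 * square_sum V + triangles V \<le> 0"
        using S tri by (simp add: algebra_simps)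
      then have "0 \<le> b * (n * (D + D\<^sup>2) - 2 * square_sum V + triangles V)"
        using b by (rule mult_nonpos_nonpos[rotated])
      moreover have "(1 + D) * g D \<le> A * (1 / A)"
        using g_le[OF D0] False A D0 by (intro mult_mono) auto
      then have "0 \<le> n * (1 - (1 + D) * g D)"
        using n A by simp
      ultimately show ?thesis by linarith
    qed
    then obtain v where v: "v \<in> V" and gain: "n * g D \<le> 1
        + real (card (V - insert v (nbhd V v))) * g D
        + b * (total (V - insert v (nbhd V v)) - real (card (V - insert v (nbhd V v))) * D)"
      using exists_vertex_to_delete[OF psubset.hyps(1) 3(1) D_def, of "g D" b]
      unfolding n_def by metis
    define U where "U = V - insert v (nbhd V v)"
    have U: "U \<subset> V" "finite U" using v psubset.hyps by (auto simp: U_def)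
    obtain I where I: "I \<subseteq> U" "independent I" "card U * g (total U / card U) \<le> card I"
      using psubset.IH[OF U(1)] psubset.prems U(1) unfolding g_def by blast
    have "card U * g D + b * (total U - card U * D) \<le> card U * g (total U / card U)"
    \<comment> \<open>For empty \<open>U\<close> the average degree is a division by 0, but both
      sides vanish.\<close>
    proof (cases "U = {}")
      case False
      then have "card U > 0" using U by (simp add: card_gt_0_iff)
      moreover have "card U * (g D + b * (total U / card U - D)) \<le> card U * g (total U / card U)"
        by (intro mult_left_mono tangent) (auto simp: total_def sum_nonneg)
      ultimately show ?thesis by (simp add: algebra_simps)
    qed (simp add: total_def)
    then have "n * g D \<le> 1 + card I"
      using gain I(3) unfolding U_def by linarith
    moreover have "card (insert v I) = Suc (card I)"
      using I(1) finite_subset[OF I(1) U(2)] by (subst card_insert_disjoint) (auto simp: U_def)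
    moreover have "independent (insert v I)"
      using I sym irrefl unfolding independent_def U_def nbhd_def by blast
    moreover have "insert v I \<subseteq> V" using I U v by auto
    ultimately show ?thesis
      unfolding n_def g_def D_def by (intro exI[of _ "insert v I"]) auto
  qed
qed

end

section \<open>Graphs without a complete tripartite subgraph\<close>

context sym_irrefl_relation
begin

text \<open>Every triangle has a vertex of maximal degree.\<close>

lemma triangles_le_low:
  assumes "finite V"
  shows "triangles V
    \<le> 3 * (\<Sum>x\<in>V. real (card {(y, z). y \<in> low_nbhd V x \<and> z \<in> low_nbhd V x \<and> E y z}))"
proof -
  define f where "f x y z = adj x y * (adj x z * adj y z)" for x y z
  define g where "g x y z = of_bool (deg V y \<le> deg V x \<and> deg V z \<le> deg V x) * f x y z" for x y z
  have low: "real (card {(y, z). y \<in> low_nbhd V x \<and> z \<in> low_nbhd V x \<and> E y z})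
      = (\<Sum>y\<in>V. \<Sum>z\<in>V. g x y z)" for x
  proof -
    have "{(y, z). y \<in> low_nbhd V x \<and> z \<in> low_nbhd V x \<and> E y z}
      = {p \<in> V \<times> V. g x (fst p) (snd p) = 1}"
      by (auto simp: low_nbhd_def nbhd_def g_def f_def adj_def of_bool_def split: if_splits)
    moreover have "g x y z = of_bool (g x y z = 1)" for y z
      by (auto simp: g_def f_def adj_def of_bool_def)
    then have "(\<Sum>y\<in>V. \<Sum>z\<in>V. g x y z) = (\<Sum>p\<in>V \<times> V. of_bool (g x (fst p) (snd p) = 1))"
      by (simp add: sum.cartesian_product case_prod_unfold)
    ultimately show ?thesis
      using assms by (simp add: of_bool_def flip: sum.inter_filter)
  qed
  \<comment> \<open>\<open>f\<close> indicates ordered triangles and \<open>g\<close> those whose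
    first vertex has maximal degree. The three terms ask which vertex is maximal; permuting the
    summations makes their sums equal, whence the factor 3.\<close>
  have "f x y z \<le> g x y z + g y x z + g z x y" for x y z
    using linorder_linear[of "deg V x" "deg V y"] linorder_linear[of "deg V x" "deg V z"]
      linorder_linear[of "deg V y" "deg V z"]
    by (auto simp: g_def f_def adj_def of_bool_def intro: sym)
  then have "(\<Sum>x\<in>V. \<Sum>y\<in>V. \<Sum>z\<in>V. f x y z)
      \<le> (\<Sum>x\<in>V. \<Sum>y\<in>V. \<Sum>z\<in>V. g x y z + g y x z + g z x y)"
    by (intro sum_mono)
  also have "\<dots> = (\<Sum>x\<in>V. \<Sum>y\<in>V. \<Sum>z\<in>V. g x y z) + (\<Sum>x\<in>V. \<Sum>y\<in>V. \<Sum>z\<in>V. g y x z)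
      + (\<Sum>x\<in>V. \<Sum>y\<in>V. \<Sum>z\<in>V. g z x y)"
    by (simp only: sum.distrib)
  also have "(\<Sum>x\<in>V. \<Sum>y\<in>V. \<Sum>z\<in>V. g y x z) = (\<Sum>x\<in>V. \<Sum>y\<in>V. \<Sum>z\<in>V. g x y z)"
    by (rule sum.swap)
  also have "(\<Sum>x\<in>V. \<Sum>y\<in>V. \<Sum>z\<in>V. g z x y) = (\<Sum>x\<in>V. \<Sum>z\<in>V. \<Sum>y\<in>V. g z x y)"
    by (intro sum.cong refl sum.swap)
  also have "\<dots> = (\<Sum>x\<in>V. \<Sum>y\<in>V. \<Sum>z\<in>V. g x y z)"
    by (rule sum.swap)
  finally have "(\<Sum>x\<in>V. \<Sum>y\<in>V. \<Sum>z\<in>V. f x y z) \<le> 3 * (\<Sum>x\<in>V. \<Sum>y\<in>V. \<Sum>z\<in>V. g x y z)"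
    by simp
  moreover have "triangles V = (\<Sum>x\<in>V. \<Sum>y\<in>V. \<Sum>z\<in>V. f x y z)"
    unfolding triangles_def link_def sum_nbhd[OF assms] f_def by (simp add: sum_distrib_left)
  ultimately show ?thesis
    by (simp only: low)
qed

lemma tripartite_free_mono:
  assumes "tripartite_free t V" "U \<subseteq> V"
  shows "tripartite_free t U"
proof (rule ccontr)
  assume "\<not> tripartite_free t U"
  then obtain A B C where "A \<subseteq> U" "B \<subseteq> U" "C \<subseteq> U" "card A = t" "card B = t" "card C = t"
    "\<forall>a\<in>A. \<forall>b\<in>B. E a b" "\<forall>a\<in>A. \<forall>c\<in>C. E a c" "\<forall>b\<in>B. \<forall>c\<in>C. E b c"
    unfolding tripartite_free_def by blast
  then show False
    using assms(2) by (intro tripartite_freeD[OF assms(1), of A B C]) auto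
qed

text \<open>By Cauchy-Schwarz \<open>total V\<close> is at most \<open>square_sum V / D\<close>.
  This turns the mixed bound of \<open>low_triangles_power_le\<close> into a pure power of
  \<open>square_sum V\<close>, and taking the root leaves a saving by a fixed power of
  \<open>D\<close>.\<close>

lemma tripartite_free_few_triangles:
  assumes V: "finite V" "V \<noteq> {}" and free: "tripartite_free (Suc s) V"
    and D: "D = total V / card V" "0 < D"
  shows "triangles V \<le> 3 * root (Suc s * Suc s) (3 * real (Suc s) ^ 2 / D) * square_sum V"
proof -
  define N where "N = s * Suc s + s"
  define K where "K = 3 * real (Suc s) ^ 2"
  define M where "M = (\<Sum>x\<in>V. real (card {(y, z). y \<in> low_nbhd V x \<and> z \<in> low_nbhd V x \<and> E y z}))"
  have N: "Suc s * Suc s = Suc N"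
    by (simp add: N_def algebra_simps)
  have S0: "0 \<le> square_sum V"
    by (simp add: square_sum_def sum_nonneg)
  have n: "real (card V) > 0"
    using V by (simp add: card_gt_0_iff)
  then have tot: "total V = real (card V) * D"
    by (simp add: D)
  have "real (card V) * (real (card V) * D\<^sup>2) \<le> real (card V) * square_sum V"
    using square_sum_ge[OF V(1)] unfolding tot by (simp add: power2_eq_square mult_ac)
  then have "total V * D \<le> square_sum V"
    using n unfolding tot by (simp add: power2_eq_square mult_ac)
  then have "total V \<le> square_sum V / D"
    using D(2) by (simp add: pos_le_divide_eq)
  have "M ^ Suc N \<le> square_sum V ^ N * (K * total V)"
    using low_triangles_power_le[OF V(1) free]
    by (simp only: N N_def[symmetric] M_def K_def square_sum_def total_def of_nat_sum)
  also have "\<dots> \<le> square_sum V ^ N * (K * (square_sum V / D))"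
    using \<open>total V \<le> square_sum V / D\<close> S0 by (intro mult_left_mono) (auto simp: K_def)
  also have "\<dots> = (root (Suc N) (K / D) * square_sum V) ^ Suc N"
    using D(2) real_root_pow_pos2[of "Suc N" "K / D"] by (simp only: power_mult_distrib) (simp add: K_def)
  finally have "M \<le> root (Suc N) (K / D) * square_sum V"
    using S0 D(2) by (intro power_le_imp_le_base[of M N]) (auto simp: K_def)
  then show ?thesis
    using triangles_le_low[OF V(1)] unfolding N K_def M_def by linarith
qed

end

section \<open>Asymptotics, realisation of the tripartite subgraph, and conclusion\<close>

lemma root_times_ln_tendsto_0:
  assumes "0 < k" "0 < (K :: real)"
  shows "((\<lambda>D. (3 * root k (K / D) + 2 / D) * ln (1 + D)) \<longlongrightarrow> 0) at_top"
proof -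
  define \<delta> where "\<delta> = 1 / real k"
  have "0 < \<delta>" using assms by (simp add: \<delta>_def)
  \<comment> \<open>The root becomes \<open>C * D powr (- \<delta>)\<close>, and a fixed negative
    power of \<open>D\<close> beats the logarithm.\<close>
  define C where "C = K powr \<delta>"
  have "((\<lambda>D. D powr (- \<delta>) * ln (1 + D)) \<longlongrightarrow> 0) at_top"
    using \<open>0 < \<delta>\<close> by real_asymp
  moreover have "((\<lambda>D::real. 1 / D * ln (1 + D)) \<longlongrightarrow> 0) at_top"
    by real_asymp
  ultimately have "((\<lambda>D. 3 * C * (D powr (- \<delta>) * ln (1 + D)) + 2 * (1 / D * ln (1 + D)))
      \<longlongrightarrow> 3 * C * 0 + 2 * 0) at_top"
    by (intro tendsto_add tendsto_mult tendsto_const)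
  then have "((\<lambda>D. (3 * (C * D powr (- \<delta>)) + 2 / D) * ln (1 + D)) \<longlongrightarrow> 0) at_top"
    by (simp add: algebra_simps)
  moreover have "\<forall>\<^sub>F D in at_top. (3 * (C * D powr (- \<delta>)) + 2 / D) * ln (1 + D)
      = (3 * root k (K / D) + 2 / D) * ln (1 + D)"
    using eventually_gt_at_top[of 0]
    by eventually_elim
      (use assms in \<open>simp add: C_def root_powr_inverse \<delta>_def powr_divide powr_minus_divide inverse_eq_divide\<close>)
  ultimately show ?thesis
    by (rule Lim_transform_eventually)
qed

text \<open>Enumerating the three sets gives a map \<open>f\<close> from the tripartite graph that
  preserves arcs; the copy \<open>H\<close> is its image, with only the image arcs.\<close>

lemma contains_copy_complete_tripartite:
  assumes G: "pair_graph G"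
    and sub: "A \<subseteq> pverts G" "B \<subseteq> pverts G" "C \<subseteq> pverts G"
    and card: "card A = t" "card B = t" "card C = t"
    and arcs: "\<forall>a\<in>A. \<forall>b\<in>B. (a, b) \<in> parcs G" "\<forall>a\<in>A. \<forall>c\<in>C. (a, c) \<in> parcs G"
      "\<forall>b\<in>B. \<forall>c\<in>C. (b, c) \<in> parcs G"
  shows "contains_copy G (complete_tripartite t)"
proof -
  interpret pair_graph G by (rule G)
  have sym: "(u, v) \<in> parcs G \<Longrightarrow> (v, u) \<in> parcs G" for u v
    using pair_sym_arcs by (auto simp: symmetric_def dest: symD)
  have irrefl: "(u, u) \<notin> parcs G" for u
    using pair_no_loops by force
  have fin: "finite A" "finite B" "finite C"
    using sub pair_finite_verts finite_subset by blast+
  obtain a b c where bij: "bij_betw a {0..<t} A" "bij_betw b {0..<t} B" "bij_betw c {0..<t} C"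
    using ex_bij_betw_nat_finite[OF fin(1)] ex_bij_betw_nat_finite[OF fin(2)]
      ex_bij_betw_nat_finite[OF fin(3)] unfolding card by blast
  define K where "K = complete_tripartite t"
  define f where "f = (\<lambda>(i::nat, x). if i = 0 then a x else if i = 1 then b x else c x)"
  define H where "H = \<lparr>pverts = f ` pverts K, parcs = map_prod f f ` parcs K\<rparr>"
  have vK: "pverts K = {0, 1, 2} \<times> {0..<t}"
    by (auto simp: K_def complete_tripartite_def)
  have aK: "parcs K = {(u, v). u \<in> pverts K \<and> v \<in> pverts K \<and> fst u \<noteq> fst v}"
    by (simp add: K_def complete_tripartite_def)
  have f_mem: "f (0, x) \<in> A" "f (1, x) \<in> B" "f (2, x) \<in> C" if "x < t" for x
    using bij that by (auto simp: f_def bij_betw_def)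
  have "\<forall>a\<in>A. \<forall>b\<in>B. (b, a) \<in> parcs G" "\<forall>a\<in>A. \<forall>c\<in>C. (c, a) \<in> parcs G"
    "\<forall>b\<in>B. \<forall>c\<in>C. (c, b) \<in> parcs G"
    using arcs sym by metis+
  with f_mem arcs have adj: "(f u, f v) \<in> parcs G" if "(u, v) \<in> parcs K" for u v
    using that unfolding aK vK by auto
  have inj: "inj_on f (pverts K)"
  proof (rule inj_onI)
    fix u v assume uv: "u \<in> pverts K" "v \<in> pverts K" "f u = f v"
    \<comment> \<open>Vertices of different parts are adjacent, so a common image would carry a loop
      of \<open>G\<close>.\<close>
    then have "fst u = fst v"
      using adj[of u v] irrefl by (auto simp: aK)
    then obtain i x y where *: "u = (i, x)" "v = (i, y)"
      by (metis prod.collapse)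
    have "inj_on (\<lambda>x. f (i, x)) {0..<t}"
      using bij by (cases "i = 0"; cases "i = 1") (simp_all add: f_def bij_betw_def)
    then show "u = v"
      using uv unfolding * vK by (auto dest: inj_onD)
  qed
  have "pair_graph H"
  proof unfold_locales
    show "symmetric (with_proj H)"
      by (auto simp: symmetric_def H_def aK intro!: symI)
    have "finite (pverts K \<times> pverts K)" by (simp add: vK)
    then show "finite (parcs H)"
      by (auto simp: H_def aK intro!: finite_imageI elim: finite_subset[rotated])
    show "finite (pverts H)"
      by (simp add: H_def vK)
    show "fst e \<noteq> snd e" if "e \<in> parcs H" for e
    proof -
      obtain u v where "(u, v) \<in> parcs K" "e = (f u, f v)"
        using \<open>e \<in> parcs H\<close> by (auto simp: H_def)
      then show ?thesis
        using adj irrefl by (metis fst_conv snd_conv)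
    qed
  qed (auto simp: H_def aK)
  moreover have "subgraph (with_proj H) (with_proj G)"
  proof -
    have "pverts H \<subseteq> pverts G"
      using f_mem sub by (auto simp: H_def vK)
    moreover have "parcs H \<subseteq> parcs G"
      using adj by (auto simp: H_def)
    moreover have "wf_digraph (with_proj G)" "wf_digraph (with_proj H)"
      using G \<open>pair_graph H\<close> unfolding wf_digraph_wp_iff
      by (simp_all add: pair_graph_def pair_digraph_def pair_fin_digraph_def)
    ultimately show ?thesis
      by (simp add: subgraph_def compatible_def)
  qed
  moreover have "digraph_iso (with_proj H) (with_proj K)"
  proof -
    \<comment> \<open>The required isomorphism goes from the copy to the model, hence the inverse of
      \<open>f\<close>.\<close>
    define g where "g = the_inv_into (pverts K) f"
    have g: "g (f u) = u" if "u \<in> pverts K" for u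
      unfolding g_def using inj that by (rule the_inv_into_f_f)
    define h where "h = \<lparr>iso_verts = g, iso_arcs = map_prod g g,
      iso_head = (snd :: (nat \<times> nat) \<times> (nat \<times> nat) \<Rightarrow> _), iso_tail = fst\<rparr>"
    have "wf_digraph (with_proj H)"
      using \<open>subgraph (with_proj H) (with_proj G)\<close> by (simp add: subgraph_def)
    moreover have "inj_on g (pverts H)"
      using g by (auto simp: H_def inj_on_def)
    moreover have "inj_on (map_prod g g) (parcs H)"
      using g by (auto simp: H_def aK inj_on_def)
    ultimately have "pre_digraph.digraph_isomorphism (with_proj H) h"
      by (simp add: pre_digraph.digraph_isomorphism_def h_def)
    moreover have "g ` pverts H = pverts K"
      using g by (auto simp: H_def image_image)
    moreover have "map_prod g g ` parcs H = parcs K"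
    proof -
      have "(map_prod g g \<circ> map_prod f f) p = p" if "p \<in> parcs K" for p
        using that g by (auto simp: aK)
      then show ?thesis
        by (auto simp: H_def image_image comp_def)
    qed
    ultimately show ?thesis
      unfolding digraph_iso_def by (intro exI[of _ h]) (simp add: app_iso_def h_def with_proj_def)
  qed
  ultimately show ?thesis
    unfolding contains_copy_def K_def by blast
qed

theorem theorem1p6:
  fixes \<epsilon> :: real and t :: nat
  assumes "\<epsilon> > 0"
  shows "\<exists>d0::nat. \<forall>d::real. d \<ge> real d0 \<longrightarrow>
           (\<forall>(n::nat) (G :: 'a pair_pre_digraph).
              pair_graph G \<longrightarrow> card (pverts G) = n \<longrightarrow> average_degree G = d \<longrightarrow>
              \<not> contains_copy G (complete_tripartite t) \<longrightarrow>
              real (independence_number G) \<ge> (1 - \<epsilon>) * (real n * ln d / d))"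
proof (cases "\<epsilon> < 1")
  case False
  \<comment> \<open>For \<open>\<epsilon>\<close> at least 1 the claimed bound is nonpositive once
    \<open>d\<close> is at least 1.\<close>
  have "(1 - \<epsilon>) * (real n * ln d / d) \<le> 0" if "d \<ge> real 1" for d :: real and n :: nat
    using that False by (intro mult_nonpos_nonneg) auto
  then show ?thesis
    by (intro exI[of _ 1] allI impI order_trans[OF _ of_nat_0_le_iff])
next
  case True
  \<comment> \<open>Half of \<open>\<epsilon>\<close> is spent on the constant in Shearer's
    argument, the other half on replacing \<open>ln (d / A)\<close> by \<open>ln d\<close>.\<close>
  define c where "c = 1 - \<epsilon> / 2"
  define s where "s = t - 1"
  define \<eta> where "\<eta> D = 3 * root (Suc s * Suc s) (3 * real (Suc s) ^ 2 / D)" for D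
  have c: "0 < c" "c \<le> 1" "c < 1"
    using assms True by (auto simp: c_def)
  have "\<forall>\<^sub>F D in at_top. (\<eta> D + 2 / D) * ln (1 + D) < 1 - c"
    unfolding \<eta>_def using c
    by (intro order_tendstoD(2)[OF root_times_ln_tendsto_0]) auto
  then obtain A0 where A0: "\<And>D. D \<ge> A0 \<Longrightarrow> (\<eta> D + 2 / D) * ln (1 + D) < 1 - c"
    unfolding eventually_at_top_linorder by blast
  \<comment> \<open>The threshold \<open>A - 1\<close> must reach \<open>A0\<close>, beyond which
    the triangle saving suffices.\<close>
  define A where "A = max 2 (A0 + 1)"
  \<comment> \<open>The exponential term is chosen so that \<open>ln A\<close> is at most
    \<open>\<epsilon> / 2 * ln d\<close>.\<close>
  define d0 where "d0 = nat \<lceil>max A (exp (2 * ln A / \<epsilon>))\<rceil>"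
  show ?thesis
  proof (intro exI[of _ d0] allI impI)
    fix d :: real and n :: nat and G :: "'a pair_pre_digraph"
    assume d: "real d0 \<le> d" and G: "pair_graph G" and n: "card (pverts G) = n"
      and avg: "average_degree G = d" and free: "\<not> contains_copy G (complete_tripartite t)"
    interpret pair_graph G by (rule G)
    interpret sym_irrefl_relation "\<lambda>u v. (u, v) \<in> parcs G"
      using pair_sym_arcs pair_no_loops by unfold_locales (force simp: symmetric_def dest: symD)+
    have "tripartite_free t (pverts G)"
    proof (rule ccontr)
      assume "\<not> ?thesis"
      then obtain A B C where "A \<subseteq> pverts G" "B \<subseteq> pverts G" "C \<subseteq> pverts G"
        "card A = t" "card B = t" "card C = t" "\<forall>a\<in>A. \<forall>b\<in>B. (a, b) \<in> parcs G"
        "\<forall>a\<in>A. \<forall>c\<in>C. (a, c) \<in> parcs G" "\<forall>b\<in>B. \<forall>c\<in>C. (b, c) \<in> parcs G"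
        unfolding tripartite_free_def by blast
      then have "contains_copy G (complete_tripartite t)"
        by (rule contains_copy_complete_tripartite[OF G])
      then show False using free by contradiction
    qed
    \<comment> \<open>For \<open>t = 0\<close> the empty sets would be a forbidden configuration;
      hence \<open>Suc s\<close> is indeed \<open>t\<close>.\<close>
    moreover from this have "t \<noteq> 0"
      using tripartite_freeD[of t "pverts G" "{}" "{}" "{}"] by auto
    ultimately have tf: "tripartite_free (Suc s) (pverts G)"
      by (simp add: s_def)
    have "A \<ge> 2" by (simp add: A_def)
    have "max A (exp (2 * ln A / \<epsilon>)) \<le> d"
      using d unfolding d0_def by linarith
    then have dA: "A \<le> d" "exp (2 * ln A / \<epsilon>) \<le> d" by auto
    have "ln (exp (2 * ln A / \<epsilon>)) \<le> ln d"
      using dA \<open>A \<ge> 2\<close> by (subst ln_le_cancel_iff) auto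
    then have ln_A: "ln A \<le> \<epsilon> / 2 * ln d"
      using assms by (simp add: field_simps)
    have "out_degree (with_proj G) v = deg (pverts G) v" for v
    proof -
      have "out_arcs (with_proj G) v = Pair v ` nbhd (pverts G) v"
        using wellformed' by (auto simp: out_arcs_def nbhd_def)
      then show ?thesis
        by (simp add: out_degree_def deg_def card_image inj_on_def)
    qed
    then have d_eq: "total (pverts G) / n = d"
      using avg unfolding average_degree_def total_def n by simp
    have "\<exists>I\<subseteq>pverts G. independent I \<and>
        card (pverts G) * (c / A * phi (total (pverts G) / card (pverts G) / A)) \<le> card I"
    proof (rule independent_set_few_triangles[where \<eta> = \<eta>])
      fix D assume D: "A - 1 \<le> D"
      then have "D \<ge> A0" "D > 0" by (auto simp: A_def)
      then show "0 \<le> \<eta> D \<and> (\<eta> D + 2 / D) * ln (1 + D) \<le> 1 - c"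
        using A0[of D] by (auto simp: \<eta>_def)
    next
      fix U assume U: "U \<subseteq> pverts G" "U \<noteq> {}" "A - 1 \<le> total U / card U"
      then show "triangles U \<le> \<eta> (total U / card U) * square_sum U"
        unfolding \<eta>_def using \<open>A \<ge> 2\<close> finite_subset[OF U(1) pair_finite_verts]
        by (intro tripartite_free_few_triangles[OF _ _ tripartite_free_mono[OF tf]]) auto
    qed (use c \<open>A \<ge> 2\<close> pair_finite_verts in auto)
    then obtain I where I: "I \<subseteq> pverts G" "independent I" "n * (c / A * phi (d / A)) \<le> card I"
      unfolding n d_eq by blast
    have "ln (d / A) = ln d - ln A"
      using dA \<open>A \<ge> 2\<close> by (simp add: ln_div)
    moreover have "ln (d / A) \<le> ln (1 + d / A)"
      using dA \<open>A \<ge> 2\<close> by (subst ln_le_cancel_iff) (auto simp: add_pos_pos)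
    ultimately have "ln d - ln A \<le> ln (1 + d / A)"
      by simp
    then have "(1 - \<epsilon>) * ln d \<le> c * ln (1 + d / A)"
    proof -
      have "c * (ln d - ln A) \<ge> c * (ln d - \<epsilon> / 2 * ln d)"
        using ln_A c by (intro mult_left_mono) auto
      \<comment> \<open>The square of \<open>1 - \<epsilon> / 2\<close> exceeds
        \<open>1 - \<epsilon>\<close> by \<open>\<epsilon>\<^sup>2 / 4\<close>.\<close>
      moreover have "c * (ln d - \<epsilon> / 2 * ln d) = (1 - \<epsilon>) * ln d + \<epsilon>\<^sup>2 / 4 * ln d"
        by (simp add: c_def field_simps power2_eq_square)
      moreover have "0 \<le> \<epsilon>\<^sup>2 / 4 * ln d"
        using dA \<open>A \<ge> 2\<close> by auto
      moreover have "c * (ln d - ln A) \<le> c * ln (1 + d / A)"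
        using c \<open>ln d - ln A \<le> ln (1 + d / A)\<close> by (intro mult_left_mono) auto
      ultimately show ?thesis by linarith
    qed
    then have "n * ((1 - \<epsilon>) * ln d / d) \<le> n * (c * ln (1 + d / A) / d)"
      using dA \<open>A \<ge> 2\<close> by (intro mult_left_mono divide_right_mono) auto
    also have "\<dots> = n * (c / A * phi (d / A))"
      using dA \<open>A \<ge> 2\<close> by (simp add: phi_def)
    also have "\<dots> \<le> card I" by (rule I(3))
    also have "card I \<le> independence_number G"
      unfolding independence_number_def
    proof (rule Max_ge)
      have "{card S |S. independent_set G S} \<subseteq> card ` Pow (pverts G)"
        by (auto simp: independent_set_def)
      then show "finite {card S |S. independent_set G S}"
        using pair_finite_verts by (meson finite_Pow_iff finite_imageI finite_subset)
      show "card I \<in> {card S |S. independent_set G S}"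
        using I by (auto simp: independent_set_def independent_def)
    qed
    finally show "(1 - \<epsilon>) * (real n * ln d / d) \<le> real (independence_number G)"
      by (simp add: mult_ac)
  qed
qed

end
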